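(* Let $A$ be a finite left brace. Then the adjoint group $A^\circ$ is nilpotent if and only if there is a positive integer $m$ such that $a^m=0$ for every $a\in A$. Moreover, if $a,b\in A$ are elements of distinct Sylow subgroups of the additive group of $A$ (i.e. $a$ lies in the Sylow $p$-subgroup and $b$ in the Sylow $q$-subgroup of $(A,+)$ for distinct primes $p,q$), and $(a+b)^n=0$ for some positive integer $n$, then $a\cdot b=b\cdot a=0$.
   Context: A left brace is an abelian group $(A,+)$ with a multiplication $\cdot$ such that $a\cdot(b+c)=a\cdot b+a\cdot c$ for all $a,b,c\in A$ and such that the circle operation $a\circ b=a\cdot b+a+b$ makes $A$ into a group, called the adjoint group $A^\circ$ (its identity is $0$). For $a\in A$, the powers $a^i$ are defined by $a^1=a$ and $a^{i+1}=a\cdot a^i$ for $i\ge 1$, i.e. $a^n=a\cdot(a\cdot(\cdots(a\cdot a)))$ with $n$ occurrences of $a$. *)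

theory Defs
  imports "HOL-Algebra.Generated_Groups" "HOL-Algebra.Ring" "HOL-Computational_Algebra.Primes"
begin

(* A left brace is carried by a ring record: \<oplus> and \<zero> are the additive group, \<otimes> is the brace
   multiplication.  The field one of the record plays no role and is left unconstrained. *)

definition circ :: "('a, 'b) ring_scheme \<Rightarrow> 'a \<Rightarrow> 'a \<Rightarrow> 'a"
  where "circ A a b = (a \<otimes>\<^bsub>A\<^esub> b) \<oplus>\<^bsub>A\<^esub> a \<oplus>\<^bsub>A\<^esub> b"

definition adjoint_group :: "('a, 'b) ring_scheme \<Rightarrow> 'a monoid"
  where "adjoint_group A = \<lparr>carrier = carrier A, monoid.mult = circ A, one = \<zero>\<^bsub>A\<^esub>\<rparr>"

locale left_brace = abelian_group A for A (structure) +
  assumes brace_mult_closed: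
      "\<lbrakk>a \<in> carrier A; b \<in> carrier A\<rbrakk> \<Longrightarrow> a \<otimes> b \<in> carrier A"
    and brace_distrib:
      "\<lbrakk>a \<in> carrier A; b \<in> carrier A; c \<in> carrier A\<rbrakk>
        \<Longrightarrow> a \<otimes> (b \<oplus> c) = (a \<otimes> b) \<oplus> (a \<otimes> c)"
    and adjoint_is_group: "group (adjoint_group A)"

(* Right-nested powers: \<otimes> is not associative in general, so this differs from the library's [^].
   The power with exponent 0 is deliberately left unspecified. *)
fun brace_pow :: "('a, 'b) ring_scheme \<Rightarrow> 'a \<Rightarrow> nat \<Rightarrow> 'a" where
  "brace_pow A a (Suc 0) = a"
| "brace_pow A a (Suc (Suc n)) = a \<otimes>\<^bsub>A\<^esub> brace_pow A a (Suc n)"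

definition commutator_subgroup :: "('a, 'b) monoid_scheme \<Rightarrow> 'a set \<Rightarrow> 'a set \<Rightarrow> 'a set"
  where "commutator_subgroup G H K =
    generate G (\<Union>h\<in>H. \<Union>k\<in>K. {h \<otimes>\<^bsub>G\<^esub> k \<otimes>\<^bsub>G\<^esub> inv\<^bsub>G\<^esub> h \<otimes>\<^bsub>G\<^esub> inv\<^bsub>G\<^esub> k})"

primrec lower_central :: "('a, 'b) monoid_scheme \<Rightarrow> nat \<Rightarrow> 'a set" where
  "lower_central G 0 = carrier G"
| "lower_central G (Suc n) = commutator_subgroup G (lower_central G n) (carrier G)"

definition nilpotent_group :: "('a, 'b) monoid_scheme \<Rightarrow> bool"
  where "nilpotent_group G \<longleftrightarrow> group G \<and> (\<exists>n. lower_central G n = {\<one>\<^bsub>G\<^esub>})"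

(* If p does not divide the order of G, the Sylow p-subgroup is the trivial subgroup. *)
definition sylow_subgroup :: "('a, 'b) monoid_scheme \<Rightarrow> nat \<Rightarrow> 'a set \<Rightarrow> bool"
  where "sylow_subgroup G p P \<longleftrightarrow>
    prime p \<and> subgroup P G \<and> card P = p ^ multiplicity p (order G)"

end

theory Submission
  imports Defs "HOL-Algebra.Group_Action" "HOL-Algebra.Sylow" "HOL-Algebra.Multiplicative_Group"
begin

text \<open>
  Write lam a x = a \<cdot> x + x, so that lam is an action of the adjoint group on (A, +) with
  a \<circ> b = a + lam a b, and let |A| = n m with n, m coprime; then A is the direct sum of its n-torsion
  and its m-torsion.

  If left multiplication by c is nilpotent on c modulo the m-torsion, then the circle powers of c with
  exponents n, n^2, n^3, ... descend through the preimages of the m-torsion under its iterates, since modulo the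
  next step they act trivially and are therefore the n-multiples. Hence some circle power of c with
  exponent a power of n is m-torsion, and vice versa, and Bezout writes c = u \<circ> w = w \<circ> u with u of
  n-torsion and w of m-torsion. For c = a + b uniqueness of components forces u = a and w = b, i.e.
  lam a b = b and lam b a = a. Consequently the torsion subgroups of a left nil brace are commuting
  Hall subgroups of the adjoint group.

  Both directions of the equivalence end with one counting argument: if a finite group acts by
  automorphisms on a finite group H and only the p-part acts nontrivially on a Sylow p-subgroup of H,
  then modulo each proper invariant normal subgroup there is a nontrivial fixed point. For conjugation this yields
  nilpotency of the adjoint group; for lam it yields nilpotency of left multiplications.
\<close>

section \<open>Fixed cosets of a group action\<close>

text \<open>The moved points form a union of orbits, and each of these orbits has size a power of
  \<open>p\<close> other than 1.\<close>

lemma (in group_action) p_group_dvd_card_moved: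
  assumes p: "prime p" and ord: "order G = p ^ k" and fin: "finite E"
  shows "p dvd card {x \<in> E. \<exists>g\<in>carrier G. \<phi> g x \<noteq> x}"
proof -
  let ?M = "{x \<in> E. \<exists>g\<in>carrier G. \<phi> g x \<noteq> x}"
  \<comment> \<open>As the sum of an indicator, the count can be taken orbit by orbit with
    \<open>disjoint_sum\<close>.\<close>
  define f where "f x = (if x \<in> ?M then 1 else 0 :: nat)" for x
  have G: "group G" using group_hom by (simp add: group_hom_def)
  interpret G: group G by (rule G)
  have "p dvd (\<Sum>x\<in>orb. f x)" if orb_in: "orb \<in> orbits G E \<phi>" for orb
  proof -
    obtain x where x: "x \<in> E" and orb: "orb = orbit G \<phi> x"
      using orb_in unfolding orbits_def by blast
    have orbE: "orb \<subseteq> E" using orb x element_image unfolding orbit_def by auto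
    show ?thesis
    proof (cases "\<exists>g\<in>carrier G. \<phi> g x \<noteq> x")
      case True
      have "y \<in> ?M" if y: "y \<in> orb" for y
      proof (rule ccontr)
        assume "y \<notin> ?M"
        hence fix_y: "\<forall>g\<in>carrier G. \<phi> g y = y" using y orbE by auto
        have "x \<in> orbit G \<phi> y"
          using orbit_sym[of x y] x y orbE orb by blast
        then obtain h where "h \<in> carrier G" "x = \<phi> h y" unfolding orbit_def by blast
        hence "x = y" using fix_y by simp
        thus False using fix_y True by auto
      qed
      hence "(\<Sum>x\<in>orb. f x) = card orb" unfolding f_def by simp
      moreover have "card orb dvd p ^ k"
        using orbit_stabilizer_theorem[OF x] ord orb by (metis dvd_triv_left)
      then obtain i where i: "card orb = p ^ i" using divides_primepow_nat[OF p] by blast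
      moreover have "i \<noteq> 0"
      proof
        assume "i = 0"
        then have "card orb = 1" using i by simp
        then obtain z where "orb = {z}" by (auto simp: card_1_singleton_iff)
        moreover have "x \<in> orb" using orb orbit_refl x by simp
        moreover obtain g where "g \<in> carrier G" "\<phi> g x \<noteq> x" using True by blast
        moreover have "\<phi> g x \<in> orb" using \<open>g \<in> carrier G\<close> orb unfolding orbit_def by blast
        ultimately show False by auto
      qed
      ultimately show ?thesis by simp
    next
      case False
      hence "orb = {x}" unfolding orb orbit_def by (auto intro!: exI[of _ \<one>])
      thus ?thesis using False unfolding f_def by auto
    qed
  qed
  hence "p dvd (\<Sum>orb\<in>orbits G E \<phi>. \<Sum>x\<in>orb. f x)" by (rule dvd_sum)
  also have "\<dots> = (\<Sum>x\<in>E. f x)" using disjoint_sum[OF fin] .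
  also have "\<dots> = card ?M" unfolding f_def using fin by (simp add: sum.If_cases Int_def)
  finally show ?thesis .
qed

text \<open>The image is isomorphic to the quotient by the kernel. This bounds the number of cosets
  of a normal subgroup that meet a Sylow subgroup, since they form the image of the latter in the
  quotient group.\<close>

lemma (in group_hom) card_image_dvd:
  shows "card (h ` carrier G) dvd order G"
proof -
  let ?I = "H\<lparr>carrier := h ` carrier G\<rparr>"
  have "group ?I" by (rule H.subgroup_imp_group[OF img_is_subgroup])
  moreover have "h \<in> hom G ?I" using homh unfolding hom_def by auto
  ultimately interpret K: group_hom G ?I h
    unfolding group_hom_def group_hom_axioms_def using G.group_axioms by blast
  have "(G Mod kernel G ?I h) \<cong> H\<lparr>carrier := h ` carrier G\<rparr>"
    by (rule K.FactGroup_iso) simp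
  hence "card (carrier (G Mod kernel G ?I h)) = card (h ` carrier G)"
    by (auto dest: iso_same_card)
  thus ?thesis
    using G.lagrange[OF K.subgroup_kernel] by (metis FactGroup_def dvd_triv_left partial_object.select_convs(1))
qed

text \<open>A group acts on the cosets of an invariant normal subgroup N; the p-group P moves a number of
  the cosets meeting the Sylow subgroup S that is divisible by p, and it fixes N itself, so it fixes
  another such coset.\<close>

lemma invariant_coset_exists:
  fixes G :: "('g, 'm) monoid_scheme" and H :: "('h, 'n) monoid_scheme"
  assumes "group G" "group H" and fin: "finite (carrier H)"
    and hom: "\<And>g. g \<in> carrier G \<Longrightarrow> \<phi> g \<in> hom H H"
    and mult: "\<And>g h x. \<lbrakk>g \<in> carrier G; h \<in> carrier G; x \<in> carrier H\<rbrakk> \<Longrightarrow> \<phi> (g \<otimes>\<^bsub>G\<^esub> h) x = \<phi> g (\<phi> h x)"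
    and one: "\<And>x. x \<in> carrier H \<Longrightarrow> \<phi> \<one>\<^bsub>G\<^esub> x = x"
    and N: "N \<lhd> H" "N \<noteq> carrier H" "\<And>g x. \<lbrakk>g \<in> carrier G; x \<in> N\<rbrakk> \<Longrightarrow> \<phi> g x \<in> N"
    and sylow: "\<And>p. prime p \<Longrightarrow> \<exists>P Q S k. subgroup P G \<and> card P = p ^ k \<and> Q \<subseteq> carrier G \<and>
        (\<forall>g\<in>carrier G. \<exists>u\<in>P. \<exists>v\<in>Q. g = u \<otimes>\<^bsub>G\<^esub> v) \<and> sylow_subgroup H p S \<and>
        (\<forall>g\<in>P. \<forall>x\<in>S. \<phi> g x \<in> S) \<and> (\<forall>g\<in>Q. \<forall>x\<in>S. \<phi> g x = x)"
  shows "\<exists>x\<in>carrier H - N. \<forall>g\<in>carrier G. \<phi> g x \<otimes>\<^bsub>H\<^esub> inv\<^bsub>H\<^esub> x \<in> N"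
proof -
  interpret G: group G by fact
  interpret H: group H by fact
  interpret N: normal N H by fact
  have subN: "subgroup N H" by (rule N.subgroup_axioms)
  have idx: "card (rcosets\<^bsub>H\<^esub> N) * card N = order H" by (rule H.lagrange[OF subN])
  have "card (rcosets\<^bsub>H\<^esub> N) \<noteq> 1"
  proof
    assume "card (rcosets\<^bsub>H\<^esub> N) = 1"
    hence "card N = card (carrier H)" using idx by (simp add: order_def)
    thus False using N(2) card_subset_eq[OF fin N.subset] by simp
  qed
  then obtain p where p: "prime p" and pidx: "p dvd card (rcosets\<^bsub>H\<^esub> N)"
    using prime_factor_nat by blast
  from sylow[OF p] obtain P Q S k where P: "subgroup P G" "card P = p ^ k" and Q: "Q \<subseteq> carrier G"
    and PQ: "\<forall>g\<in>carrier G. \<exists>u\<in>P. \<exists>v\<in>Q. g = u \<otimes>\<^bsub>G\<^esub> v" and S: "sylow_subgroup H p S"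
    and PS: "\<forall>g\<in>P. \<forall>x\<in>S. \<phi> g x \<in> S" and QS: "\<forall>g\<in>Q. \<forall>x\<in>S. \<phi> g x = x"
    by (elim exE conjE)
  have subS: "subgroup S H" and cardS: "card S = p ^ multiplicity p (order H)"
    using S unfolding sylow_subgroup_def by auto
  have Psub: "P \<subseteq> carrier G" using P(1) by (rule subgroup.subset)
  have Ssub: "S \<subseteq> carrier H" using subS by (rule subgroup.subset)
  have ordpos: "order H \<noteq> 0" using fin H.order_gt_0_iff_finite by simp
  \<comment> \<open>If \<open>S\<close> were inside \<open>N\<close>, then \<open>p * card S\<close>
    would divide \<open>order H\<close>, against the choice of the exponent of \<open>p\<close>.
    This is why \<open>p\<close> is taken to divide the index of \<open>N\<close>.\<close>
  have SN: "\<not> S \<subseteq> N"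
  proof
    assume "S \<subseteq> N"
    hence "subgroup S (H\<lparr>carrier := N\<rparr>)" using H.subgroup_incl subS subN by blast
    hence "card S dvd card N"
      using group.lagrange[OF H.subgroup_imp_group[OF subN], of S] by (simp add: order_def dvd_def)
        (metis mult.commute)
    hence "p * p ^ multiplicity p (order H) dvd order H"
      using mult_dvd_mono[OF pidx, of "card S" "card N"] cardS idx by simp
    hence "p ^ Suc (multiplicity p (order H)) dvd order H" by simp
    moreover have "\<not> is_unit p" using p by auto
    ultimately show False
      using power_dvd_iff_le_multiplicity[of "order H" p "Suc (multiplicity p (order H))"] ordpos by simp
  qed
  define E where "E = (\<lambda>x. N #>\<^bsub>H\<^esub> x) ` S"
  have finE: "finite E" unfolding E_def using finite_subset[OF Ssub fin] by simp
  have cE: "C \<subseteq> carrier H" if "C \<in> E" for C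
    using that H.r_coset_subset_G[OF N.subset] Ssub unfolding E_def by blast
  have img: "\<phi> g ` (N #>\<^bsub>H\<^esub> x) = N #>\<^bsub>H\<^esub> \<phi> g x" if g: "g \<in> carrier G" and x: "x \<in> carrier H" for g x
  proof -
    have closed: "\<phi> h y \<in> carrier H" if "h \<in> carrier G" "y \<in> carrier H" for h y
      using hom that unfolding hom_def by blast
    have *: "\<phi> h ` (N #>\<^bsub>H\<^esub> y) \<subseteq> N #>\<^bsub>H\<^esub> \<phi> h y" if h: "h \<in> carrier G" and y: "y \<in> carrier H" for h y
    proof
      fix z assume "z \<in> \<phi> h ` (N #>\<^bsub>H\<^esub> y)"
      then obtain n where n: "n \<in> N" "z = \<phi> h (n \<otimes>\<^bsub>H\<^esub> y)" unfolding r_coset_def by auto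
      hence "z = \<phi> h n \<otimes>\<^bsub>H\<^esub> \<phi> h y" using hom_mult[OF hom[OF h], of n y] y N.mem_carrier by simp
      thus "z \<in> N #>\<^bsub>H\<^esub> \<phi> h y" using N(3)[OF h n(1)] unfolding r_coset_def by auto
    qed
    \<comment> \<open>The reverse inclusion comes from the inclusion \<open>*\<close> for the
      inverse of \<open>g\<close>.\<close>
    show ?thesis
    proof (rule subset_antisym[OF *[OF g x]], rule subsetI)
      fix z assume z: "z \<in> N #>\<^bsub>H\<^esub> \<phi> g x"
      have zc: "z \<in> carrier H" using z H.r_coset_subset_G[OF N.subset closed[OF g x]] by blast
      have "\<phi> (inv\<^bsub>G\<^esub> g) z \<in> N #>\<^bsub>H\<^esub> \<phi> (inv\<^bsub>G\<^esub> g) (\<phi> g x)"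
        using *[of "inv\<^bsub>G\<^esub> g" "\<phi> g x"] z closed g x by blast
      also have "\<phi> (inv\<^bsub>G\<^esub> g) (\<phi> g x) = x" using mult[of "inv\<^bsub>G\<^esub> g" g x] one g x by simp
      finally have "\<phi> g (\<phi> (inv\<^bsub>G\<^esub> g) z) \<in> \<phi> g ` (N #>\<^bsub>H\<^esub> x)" by blast
      moreover have "\<phi> g (\<phi> (inv\<^bsub>G\<^esub> g) z) = z" using mult[of g "inv\<^bsub>G\<^esub> g" z] one g zc by simp
      ultimately show "z \<in> \<phi> g ` (N #>\<^bsub>H\<^esub> x)" by simp
    qed
  qed
  \<comment> \<open>The restriction to \<open>E\<close> is there because the members of
    \<open>Bij E\<close> are extensional.\<close>
  define \<psi> where "\<psi> g = (\<lambda>C\<in>E. \<phi> g ` C)" for g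
  have imgE: "\<phi> g ` C \<in> E" if g: "g \<in> P" and C: "C \<in> E" for g C
  proof -
    obtain x where x: "x \<in> S" "C = N #>\<^bsub>H\<^esub> x" using C unfolding E_def by blast
    hence "\<phi> g ` C = N #>\<^bsub>H\<^esub> \<phi> g x" using img[of g x] g Psub Ssub by blast
    thus ?thesis unfolding E_def using PS g x(1) by blast
  qed
  have comp: "\<phi> g ` \<phi> h ` C = \<phi> (g \<otimes>\<^bsub>G\<^esub> h) ` C" if "g \<in> P" "h \<in> P" "C \<in> E" for g h C
    unfolding image_image
  proof (rule image_cong[OF refl])
    fix x assume "x \<in> C"
    hence "x \<in> carrier H" using cE[OF that(3)] by blast
    thus "\<phi> g (\<phi> h x) = \<phi> (g \<otimes>\<^bsub>G\<^esub> h) x" using mult[of g h x] that Psub by (simp add: subset_iff)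
  qed
  have idE: "\<phi> \<one>\<^bsub>G\<^esub> ` C = C" if "C \<in> E" for C
    using image_cong[OF refl, of C "\<phi> \<one>\<^bsub>G\<^esub>" "\<lambda>x. x"] cE[OF that] one by (simp add: subset_iff)
  have grpP: "group (G\<lparr>carrier := P\<rparr>)" by (rule G.subgroup_imp_group[OF P(1)])
  interpret act: group_action "G\<lparr>carrier := P\<rparr>" E \<psi>
  proof (unfold group_action_def group_hom_def group_hom_axioms_def, intro conjI)
    show "group (G\<lparr>carrier := P\<rparr>)" "group (BijGroup E)" by (rule grpP, rule group_BijGroup)
    have bij: "\<psi> g \<in> Bij E" if g: "g \<in> P" for g
    proof -
      have ig: "inv\<^bsub>G\<^esub> g \<in> P" using P(1) g by (rule subgroup.m_inv_closed)
      have "bij_betw (\<psi> g) E E"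
      proof (rule bij_betw_byWitness[where f' = "\<psi> (inv\<^bsub>G\<^esub> g)"])
        have "g \<in> carrier G" using g Psub by blast
        then show "\<forall>C\<in>E. \<psi> (inv\<^bsub>G\<^esub> g) (\<psi> g C) = C" "\<forall>C\<in>E. \<psi> g (\<psi> (inv\<^bsub>G\<^esub> g) C) = C"
          using g ig imgE comp idE unfolding \<psi>_def by simp_all
        show "\<psi> g ` E \<subseteq> E" "\<psi> (inv\<^bsub>G\<^esub> g) ` E \<subseteq> E"
          using g ig imgE unfolding \<psi>_def by auto
      qed
      thus ?thesis unfolding Bij_def \<psi>_def by auto
    qed
    show "\<psi> \<in> hom (G\<lparr>carrier := P\<rparr>) (BijGroup E)"
    proof (rule homI)
      fix g assume "g \<in> carrier (G\<lparr>carrier := P\<rparr>)"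
      thus "\<psi> g \<in> carrier (BijGroup E)" using bij by (simp add: BijGroup_def)
    next
      fix g h assume "g \<in> carrier (G\<lparr>carrier := P\<rparr>)" "h \<in> carrier (G\<lparr>carrier := P\<rparr>)"
      hence gh: "g \<in> P" "h \<in> P" by auto
      have "\<psi> (g \<otimes>\<^bsub>G\<^esub> h) = compose E (\<psi> g) (\<psi> h)"
        unfolding compose_def \<psi>_def using gh imgE comp by (auto simp: fun_eq_iff)
      thus "\<psi> (g \<otimes>\<^bsub>G\<lparr>carrier := P\<rparr>\<^esub> h) = \<psi> g \<otimes>\<^bsub>BijGroup E\<^esub> \<psi> h"
        using gh bij by (simp add: BijGroup_def)
    qed
  qed
  define M where "M = {C \<in> E. \<exists>g\<in>carrier (G\<lparr>carrier := P\<rparr>). \<psi> g C \<noteq> C}"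
  have pM: "p dvd card M" unfolding M_def
    by (rule act.p_group_dvd_card_moved[OF p _ finE, of k]) (simp add: order_def P(2))
  \<comment> \<open>\<open>E\<close> is the image of \<open>S\<close> in \<open>H Mod N\<close>, so
    its size is a power of \<open>p\<close>; it is not 1 because \<open>S\<close> has an element
    outside \<open>N\<close>.\<close>
  have pE: "p dvd card E"
  proof -
    interpret SH: group_hom "H\<lparr>carrier := S\<rparr>" "H Mod N" "\<lambda>x. N #>\<^bsub>H\<^esub> x"
    proof (unfold group_hom_def group_hom_axioms_def, intro conjI)
      show "group (H\<lparr>carrier := S\<rparr>)" by (rule H.subgroup_imp_group[OF subS])
      show "group (H Mod N)" by (rule N.factorgroup_is_group)
      show "(#>\<^bsub>H\<^esub>) N \<in> hom (H\<lparr>carrier := S\<rparr>) (H Mod N)"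
        using N.r_coset_hom_Mod Ssub by (simp add: hom_def Pi_iff subset_iff)
    qed
    have "card E dvd p ^ multiplicity p (order H)"
      using SH.card_image_dvd unfolding E_def order_def by (simp add: cardS[unfolded order_def])
    then obtain i where i: "card E = p ^ i" using divides_primepow_nat[OF p] by blast
    have "i \<noteq> 0"
    proof
      assume "i = 0"
      then obtain C where C: "E = {C}" using i by (auto simp: card_1_singleton_iff)
      obtain s where s: "s \<in> S" "s \<notin> N" using SN by blast
      have "N #>\<^bsub>H\<^esub> s = N #>\<^bsub>H\<^esub> \<one>\<^bsub>H\<^esub>"
        using C s(1) subgroup.one_closed[OF subS] unfolding E_def by (metis image_eqI singletonD)
      hence "N #>\<^bsub>H\<^esub> s = N" using H.coset_mult_one[OF N.subset] by simp
      thus False using s H.rcos_self[OF _ subN, of s] Ssub by auto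
    qed
    thus ?thesis using i by simp
  qed
  have NE: "N \<in> E" unfolding E_def
    using subgroup.one_closed[OF subS] H.coset_mult_one[OF N.subset] by force
  have "\<phi> g ` N = N" if "g \<in> P" for g
    using img[of g "\<one>\<^bsub>H\<^esub>"] that Psub H.coset_mult_one[OF N.subset] hom_one[OF hom[of g]] \<open>group H\<close> by auto
  hence NM: "N \<notin> M" unfolding M_def \<psi>_def using NE by auto
  \<comment> \<open>If \<open>N\<close> were the only coset that is not moved, \<open>card E\<close>
    would be \<open>card M + 1\<close>, while \<open>p\<close> divides both cardinalities.\<close>
  have "E \<noteq> insert N M"
  proof
    assume "E = insert N M"
    hence "card E = Suc (card M)" using NM finE by (metis card_insert_disjoint finite_insert)
    hence "p dvd 1" using pE pM by (metis dvd_add_right_iff plus_1_eq_Suc add.commute)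
    thus False using p by (metis not_prime_unit)
  qed
  moreover have "insert N M \<subseteq> E" using NE unfolding M_def by auto
  ultimately obtain C where C: "C \<in> E" "C \<noteq> N" "C \<notin> M" by blast
  then obtain x where x: "x \<in> S" "C = N #>\<^bsub>H\<^esub> x" unfolding E_def by blast
  have xH: "x \<in> carrier H" using x Ssub by blast
  have xN: "x \<notin> N" using C(2) x H.coset_join2[OF xH subN] by auto
  \<comment> \<open>Since \<open>Q\<close> fixes \<open>x\<close> itself, only the factor from
    \<open>P\<close> matters, and that factor fixes the coset of \<open>x\<close>.\<close>
  have "\<phi> g x \<otimes>\<^bsub>H\<^esub> inv\<^bsub>H\<^esub> x \<in> N" if g: "g \<in> carrier G" for g
  proof -
    obtain u v where uv: "u \<in> P" "v \<in> Q" "g = u \<otimes>\<^bsub>G\<^esub> v" using PQ g by blast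
    have "\<phi> g x = \<phi> u x" using mult[of u v x] uv QS x(1) Psub Q xH by auto
    moreover have "\<phi> u ` C = C" using C(1,3) uv(1) unfolding M_def \<psi>_def by auto
    moreover have "x \<in> C" using x(2) H.rcos_self[OF xH subN] by simp
    ultimately have "\<phi> g x \<in> N #>\<^bsub>H\<^esub> x" using x(2) by blast
    thus ?thesis using N.rcos_module_imp[OF \<open>group H\<close> xH] by blast
  qed
  thus ?thesis using xH xN by blast
qed

section \<open>Finite nilpotent groups\<close>

text \<open>A maximal subset of \<open>U\<close> with the property must be \<open>U\<close>. This
  replaces the explicit construction of an ascending series: it is enough to enlarge each proper
  member once.\<close>

lemma finite_ascending_property:
  assumes "finite U" "Q S0" "S0 \<subseteq> U"
    and "\<And>S. \<lbrakk>Q S; S \<subset> U\<rbrakk> \<Longrightarrow> \<exists>T. Q T \<and> S \<subset> T \<and> T \<subseteq> U"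
  shows "Q U"
proof -
  have "finite {S. Q S \<and> S \<subseteq> U}" using assms(1) by simp
  moreover have "{S. Q S \<and> S \<subseteq> U} \<noteq> {}" using assms(2,3) by blast
  ultimately obtain M where "Q M" "M \<subseteq> U" "\<And>T. \<lbrakk>Q T; T \<subseteq> U; M \<subseteq> T\<rbrakk> \<Longrightarrow> M = T"
    using finite_has_maximal[of "{S. Q S \<and> S \<subseteq> U}"] by auto
  thus ?thesis using assms(4)[of M] by (metis psubsetE psubsetI)
qed

context group
begin

lemma inv_cancel_left:
  assumes "x \<in> carrier G" "y \<in> carrier G"
  shows "inv x \<otimes> (x \<otimes> y) = y" "x \<otimes> (inv x \<otimes> y) = y"
  using assms by (simp_all add: m_assoc[symmetric])

section \<open>Commutators and the lower central series\<close>

lemma commutator_subgroup_normal: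
  assumes "H \<lhd> G" "K \<lhd> G"
  shows "commutator_subgroup G H K \<lhd> G"
  unfolding commutator_subgroup_def
proof (rule normal_generateI)
  interpret H: normal H G by fact
  interpret K: normal K G by fact
  let ?S = "\<Union>h\<in>H. \<Union>k\<in>K. {h \<otimes> k \<otimes> inv h \<otimes> inv k}"
  show "?S \<subseteq> carrier G" using H.mem_carrier K.mem_carrier by auto
  fix c g assume "c \<in> ?S" and g: "g \<in> carrier G"
  then obtain h k where hk: "h \<in> H" "k \<in> K" "c = h \<otimes> k \<otimes> inv h \<otimes> inv k" by blast
  have car: "h \<in> carrier G" "k \<in> carrier G" using hk H.mem_carrier K.mem_carrier by auto
  let ?h = "g \<otimes> h \<otimes> inv g" and ?k = "g \<otimes> k \<otimes> inv g"
  have "g \<otimes> c \<otimes> inv g = ?h \<otimes> ?k \<otimes> inv ?h \<otimes> inv ?k"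
    unfolding hk(3) using car g by (simp add: m_assoc inv_mult_group inv_cancel_left)
  moreover have "?h \<in> H" "?k \<in> K" using H.inv_op_closed2 K.inv_op_closed2 g hk by auto
  ultimately show "g \<otimes> c \<otimes> inv g \<in> ?S" by blast
qed

lemma lower_central_normal: "lower_central G n \<lhd> G"
  by (induction n) (auto intro: commutator_subgroup_normal normal_self)

lemma lower_central_commutator:
  assumes "x \<in> lower_central G n" "y \<in> carrier G"
  shows "x \<otimes> y \<otimes> inv x \<otimes> inv y \<in> lower_central G (Suc n)"
  using assms by (auto simp: commutator_subgroup_def intro!: generate.incl)

text \<open>Moving \<open>x\<close> past the i-th power of \<open>y\<close> costs the i-th power of
  \<open>z\<close>, because \<open>z\<close> commutes with both. For i = b this kills the b-th power
  of \<open>z\<close>; by symmetry the a-th power dies as well.\<close>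

lemma central_commutator_trivial:
  assumes car: "x \<in> carrier G" "y \<in> carrier G" "z \<in> carrier G"
    and xy: "x \<otimes> y = z \<otimes> (y \<otimes> x)" and zx: "z \<otimes> x = x \<otimes> z" and zy: "z \<otimes> y = y \<otimes> z"
    and a: "x [^] (a::nat) = \<one>" and b: "y [^] (b::nat) = \<one>" and "coprime a b"
  shows "z = \<one>"
proof -
  have "x \<otimes> y [^] i = z [^] i \<otimes> (y [^] i \<otimes> x)" for i :: nat
  proof (induction i)
    case (Suc i)
    have zyi: "z \<otimes> y [^] i = y [^] i \<otimes> z"
      using pow_mult_distrib[of z y] car zy
      by (induction i) (simp_all, metis (no_types, opaque_lifting) car(2,3) m_assoc nat_pow_closed)
    have "x \<otimes> y [^] Suc i = z [^] i \<otimes> (y [^] i \<otimes> (x \<otimes> y))"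
      using car Suc by (simp add: m_assoc[symmetric])
    also have "\<dots> = z [^] i \<otimes> ((y [^] i \<otimes> z) \<otimes> (y \<otimes> x))" using car xy by (simp add: m_assoc)
    also have "\<dots> = z [^] Suc i \<otimes> (y [^] Suc i \<otimes> x)"
      using car by (simp add: zyi[symmetric] m_assoc)
    finally show ?case .
  qed (use car in simp)
  from this[of b] have zb: "z [^] b = \<one>" using b car by (simp add: r_cancel_one)
  have "x [^] i \<otimes> y = z [^] i \<otimes> (y \<otimes> x [^] i)" for i :: nat
  proof (induction i)
    case (Suc i)
    have xzi: "x \<otimes> z [^] i = z [^] i \<otimes> x"
      using car zx
      by (induction i) (simp_all, metis (no_types, opaque_lifting) m_assoc nat_pow_closed)
    have "x [^] Suc i \<otimes> y = x \<otimes> (x [^] i \<otimes> y)"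
      using car nat_pow_Suc2[OF car(1), of i] by (simp add: m_assoc)
    also have "\<dots> = (x \<otimes> z [^] i) \<otimes> (y \<otimes> x [^] i)" using car Suc by (simp add: m_assoc)
    also have "\<dots> = z [^] i \<otimes> ((x \<otimes> y) \<otimes> x [^] i)" using car xzi by (simp add: m_assoc)
    also have "\<dots> = z [^] Suc i \<otimes> (y \<otimes> x [^] Suc i)"
      using car xy nat_pow_Suc2[OF car(1), of i] by (simp add: m_assoc)
    finally show ?case .
  qed (use car in simp)
  from this[of a] have za: "z [^] a = \<one>" using a car by (simp add: r_cancel_one)
  have "ord z dvd 1" using za zb car pow_eq_id \<open>coprime a b\<close> by (meson coprime_def)
  thus ?thesis using ord_eq_1[of z] car by simp
qed

text \<open>The commutator of \<open>x\<close> and \<open>y\<close> sinks through the whole lower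
  central series: if it lies in one term, it is central modulo the next, and there the coprime
  exponents make it trivial.\<close>

lemma nilpotent_imp_coprime_commute:
  assumes "nilpotent_group G" "x \<in> carrier G" "y \<in> carrier G"
    and a: "x [^] (a::nat) = \<one>" and b: "y [^] (b::nat) = \<one>" and "coprime a b"
  shows "x \<otimes> y = y \<otimes> x"
proof -
  let ?z = "x \<otimes> y \<otimes> inv x \<otimes> inv y"
  note car = assms(2,3)
  have z: "?z \<in> carrier G" using car by simp
  have "?z \<in> lower_central G n" for n
  proof (induction n)
    case (Suc n)
    let ?N = "lower_central G (Suc n)"
    interpret N: normal ?N G by (rule lower_central_normal)
    let ?Q = "G Mod ?N"
    interpret Q: group ?Q by (rule N.factorgroup_is_group)
    interpret h: group_hom G ?Q "\<lambda>x. ?N #> x"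
      using N.r_coset_hom_Mod N.factorgroup_is_group
      by (simp add: group_hom_def group_hom_axioms_def group_axioms)
    have rel: "u \<otimes> v = w \<otimes> (v \<otimes> u)" if "u \<in> carrier G" "v \<in> carrier G" "w = u \<otimes> v \<otimes> inv u \<otimes> inv v" for u v w
      using that by (simp add: m_assoc inv_cancel_left)
    have comm: "(?N #> ?z) \<otimes>\<^bsub>?Q\<^esub> (?N #> g) = (?N #> g) \<otimes>\<^bsub>?Q\<^esub> (?N #> ?z)" if g: "g \<in> carrier G" for g
    proof -
      let ?c = "?z \<otimes> g \<otimes> inv ?z \<otimes> inv g"
      have "?c \<in> ?N" using lower_central_commutator[OF Suc g] .
      hence c: "?N #> ?c = \<one>\<^bsub>?Q\<^esub>" using coset_join2[of ?c ?N] N.subgroup_axioms z g by simp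
      have "?z \<otimes> g = ?c \<otimes> (g \<otimes> ?z)" by (rule rel[OF z g refl])
      hence "(?N #> ?z) \<otimes>\<^bsub>?Q\<^esub> (?N #> g) = (?N #> ?c) \<otimes>\<^bsub>?Q\<^esub> ((?N #> g) \<otimes>\<^bsub>?Q\<^esub> (?N #> ?z))"
        using z g h.hom_mult[of ?z g] h.hom_mult[of ?c "g \<otimes> ?z"] h.hom_mult[of g ?z] by simp
      also have "\<dots> = (?N #> g) \<otimes>\<^bsub>?Q\<^esub> (?N #> ?z)"
        unfolding c by (rule Q.l_one[OF Q.m_closed[OF h.hom_closed[OF g] h.hom_closed[OF z]]])
      finally show ?thesis .
    qed
    have "?N #> ?z = \<one>\<^bsub>?Q\<^esub>"
    proof (rule Q.central_commutator_trivial[of "?N #> x" "?N #> y" _ a b])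
      have "x \<otimes> y = ?z \<otimes> (y \<otimes> x)" by (rule rel[OF car refl])
      thus "(?N #> x) \<otimes>\<^bsub>?Q\<^esub> (?N #> y) = (?N #> ?z) \<otimes>\<^bsub>?Q\<^esub> ((?N #> y) \<otimes>\<^bsub>?Q\<^esub> (?N #> x))"
        using z car h.hom_mult[of x y] h.hom_mult[of y x] h.hom_mult[of ?z "y \<otimes> x"] by simp
      show "(?N #> x) [^]\<^bsub>?Q\<^esub> a = \<one>\<^bsub>?Q\<^esub>" "(?N #> y) [^]\<^bsub>?Q\<^esub> b = \<one>\<^bsub>?Q\<^esub>"
        using a b car h.hom_nat_pow[of x a] h.hom_nat_pow[of y b] h.hom_one by simp_all
    qed (use comm car z h.hom_closed \<open>coprime a b\<close> in auto)
    thus ?case using coset_join1[of ?N ?z] z N.subset N.subgroup_axioms by simp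
  qed (use z in simp)
  moreover obtain n where "lower_central G n = {\<one>}" using assms(1) unfolding nilpotent_group_def by blast
  ultimately have z1: "?z = \<one>" by blast
  have "x \<otimes> y = ?z \<otimes> (y \<otimes> x)" using car by (simp add: m_assoc inv_cancel_left)
  also have "\<dots> = y \<otimes> x" unfolding z1 using car by simp
  finally show ?thesis .
qed

text \<open>The hypothesis says that every nontrivial quotient of the group has a nontrivial centre.
  The proof climbs along preimages of centres and keeps track of the lower central series on the
  way.\<close>

lemma nilpotent_if_central_extensions:
  assumes fin: "finite (carrier G)"
    and step: "\<And>N. \<lbrakk>N \<lhd> G; N \<noteq> carrier G\<rbrakk> \<Longrightarrow>
      \<exists>x\<in>carrier G - N. \<forall>g\<in>carrier G. g \<otimes> x \<otimes> inv g \<otimes> inv x \<in> N"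
  shows "nilpotent_group G"
proof -
  \<comment> \<open>The number \<open>n\<close> of further steps after entering \<open>N\<close> is
    uniform in the entry index \<open>j\<close>, so that \<open>j\<close> may be shifted by one when
    \<open>N\<close> is enlarged. For \<open>N\<close> the whole group, \<open>j = 0\<close> gives
    nilpotency.\<close>
  define good where "good N \<longleftrightarrow> N \<lhd> G \<and>
    (\<exists>n. \<forall>j. lower_central G j \<subseteq> N \<longrightarrow> lower_central G (j + n) = {\<one>})" for N
  have "good (carrier G)"
  proof (rule finite_ascending_property[of _ good "{\<one>}"])
    have "\<one> \<in> lower_central G j" for j
      using lower_central_normal[of j] by (simp add: normal_imp_subgroup subgroup.one_closed)
    hence "lower_central G j \<subseteq> {\<one>} \<longrightarrow> lower_central G (j + 0) = {\<one>}" for j by auto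
    thus "good {\<one>}" using one_is_normal unfolding good_def by blast
  next
    fix N assume "good N" and NG: "N \<subset> carrier G"
    then obtain n where N: "N \<lhd> G"
      and n: "\<And>j. lower_central G j \<subseteq> N \<Longrightarrow> lower_central G (j + n) = {\<one>}"
      unfolding good_def by blast
    interpret N: normal N G by fact
    \<comment> \<open>\<open>Z\<close> is the preimage of the centre of the quotient by
      \<open>N\<close>.\<close>
    define Z where "Z = {z \<in> carrier G. \<forall>g\<in>carrier G. z \<otimes> g \<otimes> inv z \<otimes> inv g \<in> N}"
    have Zc: "z \<in> carrier G" if "z \<in> Z" for z using that unfolding Z_def by blast
    have Zd: "z \<otimes> g \<otimes> inv z \<otimes> inv g \<in> N" if "z \<in> Z" "g \<in> carrier G" for z g
      using that unfolding Z_def by blast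
    have "subgroup Z G"
    proof (rule subgroupI)
      show "Z \<subseteq> carrier G" "Z \<noteq> {}" unfolding Z_def by auto
    next
      fix z assume z: "z \<in> Z"
      have "inv z \<otimes> g \<otimes> inv (inv z) \<otimes> inv g \<in> N" if g: "g \<in> carrier G" for g
      proof -
        \<comment> \<open>The commutator of \<open>inv z\<close> with \<open>g\<close> is the
          conjugate by \<open>inv z\<close> of the inverse of the commutator of \<open>z\<close>
          with \<open>g\<close>.\<close>
        have "inv z \<otimes> inv (z \<otimes> g \<otimes> inv z \<otimes> inv g) \<otimes> inv (inv z) \<in> N"
          using N.inv_op_closed2[of "inv z"] Zd[OF z g] Zc[OF z] N.m_inv_closed by blast
        also have "inv z \<otimes> inv (z \<otimes> g \<otimes> inv z \<otimes> inv g) \<otimes> inv (inv z) = inv z \<otimes> g \<otimes> inv (inv z) \<otimes> inv g"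
          using Zc[OF z] g by (simp add: m_assoc inv_mult_group inv_cancel_left)
        finally show ?thesis .
      qed
      thus "inv z \<in> Z" using Zc[OF z] unfolding Z_def by blast
    next
      fix z w assume zw: "z \<in> Z" "w \<in> Z"
      have "z \<otimes> w \<otimes> g \<otimes> inv (z \<otimes> w) \<otimes> inv g \<in> N" if g: "g \<in> carrier G" for g
      proof -
        have "z \<otimes> (w \<otimes> g \<otimes> inv w \<otimes> inv g) \<otimes> inv z \<in> N"
          using N.inv_op_closed2 Zd[OF zw(2) g] Zc[OF zw(1)] by auto
        \<comment> \<open>With [x, y] for commutators, the identity behind this is [zw, g] = z
          [w, g] z^-1 [z, g].\<close>
        hence "z \<otimes> (w \<otimes> g \<otimes> inv w \<otimes> inv g) \<otimes> inv z \<otimes> (z \<otimes> g \<otimes> inv z \<otimes> inv g) \<in> N"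
          using Zd[OF zw(1) g] by blast
        also have "z \<otimes> (w \<otimes> g \<otimes> inv w \<otimes> inv g) \<otimes> inv z \<otimes> (z \<otimes> g \<otimes> inv z \<otimes> inv g) =
            z \<otimes> w \<otimes> g \<otimes> inv (z \<otimes> w) \<otimes> inv g"
          using zw[THEN Zc] g by (simp add: m_assoc inv_mult_group inv_cancel_left)
        finally show ?thesis .
      qed
      thus "z \<otimes> w \<in> Z" using zw[THEN Zc] unfolding Z_def by blast
    qed
    moreover have "k \<otimes> z \<otimes> inv k \<in> Z" if k: "k \<in> carrier G" and z: "z \<in> Z" for k z
    proof -
      have "(k \<otimes> z \<otimes> inv k) \<otimes> g \<otimes> inv (k \<otimes> z \<otimes> inv k) \<otimes> inv g \<in> N" if g: "g \<in> carrier G" for g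
      proof -
        \<comment> \<open>Conjugation by \<open>k\<close> turns the commutator of \<open>z\<close>
          with \<open>?g\<close> into the commutator of the conjugate of \<open>z\<close> with
          \<open>g\<close>.\<close>
        let ?g = "inv k \<otimes> g \<otimes> k"
        have "k \<otimes> (z \<otimes> ?g \<otimes> inv z \<otimes> inv ?g) \<otimes> inv k \<in> N"
          using N.inv_op_closed2[OF k] Zd[OF z, of ?g] g k by simp
        also have "k \<otimes> (z \<otimes> ?g \<otimes> inv z \<otimes> inv ?g) \<otimes> inv k =
            (k \<otimes> z \<otimes> inv k) \<otimes> g \<otimes> inv (k \<otimes> z \<otimes> inv k) \<otimes> inv g"
          using Zc[OF z] k g by (simp add: m_assoc inv_mult_group inv_cancel_left)
        finally show ?thesis .
      qed
      thus ?thesis using Zc[OF z] k unfolding Z_def by simp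
    qed
    ultimately have Z: "Z \<lhd> G" by (auto simp: normal_inv_iff)
    have "lower_central G (j + Suc n) = {\<one>}" if j: "lower_central G j \<subseteq> Z" for j
    proof -
      \<comment> \<open>Once a term lies in \<open>Z\<close>, the next one lies in \<open>N\<close>,
        so passing from \<open>N\<close> to \<open>Z\<close> costs one step.\<close>
      have "lower_central G (Suc j) \<subseteq> N"
        unfolding lower_central.simps commutator_subgroup_def
        by (rule generate_subgroup_incl[OF _ N.subgroup_axioms]) (use j Zd in blast)
      thus ?thesis using n[of "Suc j"] by simp
    qed
    hence "good Z" unfolding good_def using Z by blast
    moreover have "N \<subseteq> Z"
    proof
      fix z assume z: "z \<in> N"
      have "z \<otimes> (g \<otimes> inv z \<otimes> inv g) \<in> N" if "g \<in> carrier G" for g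
        using that z N.inv_op_closed2 by auto
      thus "z \<in> Z" unfolding Z_def using z N.mem_carrier by (simp add: m_assoc)
    qed
    moreover obtain x where x: "x \<in> carrier G" "x \<notin> N" "\<And>g. g \<in> carrier G \<Longrightarrow> g \<otimes> x \<otimes> inv g \<otimes> inv x \<in> N"
      using step[OF N] NG by blast
    have "x \<otimes> g \<otimes> inv x \<otimes> inv g \<in> N" if g: "g \<in> carrier G" for g
    proof -
      have "inv (g \<otimes> x \<otimes> inv g \<otimes> inv x) \<in> N" using x(3)[OF g] by simp
      thus ?thesis using x(1) g by (simp add: m_assoc inv_mult_group)
    qed
    hence "x \<in> Z" unfolding Z_def using x(1) by blast
    ultimately show "\<exists>T. good T \<and> N \<subset> T \<and> T \<subseteq> carrier G" using x(2) Zc by blast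
  qed (use fin in auto)
  then obtain n where "lower_central G (0 + n) = {\<one>}" unfolding good_def by (metis lower_central.simps(1) order_refl)
  thus ?thesis unfolding nilpotent_group_def using group_axioms by auto
qed

text \<open>The group acts on itself by conjugation, and \<open>P\<close> is both the acting
  p-subgroup and the Sylow subgroup acted on. Since \<open>Q\<close> centralizes \<open>P\<close>,
  it acts trivially there.\<close>

lemma nilpotent_if_sylow_factors:
  assumes fin: "finite (carrier G)"
    and sylow: "\<And>p. prime p \<Longrightarrow> \<exists>P Q. sylow_subgroup G p P \<and> Q \<subseteq> carrier G \<and>
        (\<forall>g\<in>carrier G. \<exists>u\<in>P. \<exists>v\<in>Q. g = u \<otimes> v) \<and> (\<forall>u\<in>P. \<forall>v\<in>Q. u \<otimes> v = v \<otimes> u)"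
  shows "nilpotent_group G"
proof (rule nilpotent_if_central_extensions[OF fin])
  fix N assume N: "N \<lhd> G" "N \<noteq> carrier G"
  interpret N: normal N G by fact
  show "\<exists>x\<in>carrier G - N. \<forall>g\<in>carrier G. g \<otimes> x \<otimes> inv g \<otimes> inv x \<in> N"
  proof (rule invariant_coset_exists[OF group_axioms group_axioms fin, of "\<lambda>g x. g \<otimes> x \<otimes> inv g"])
    fix p :: nat assume "prime p"
    then obtain P Q where PQ: "sylow_subgroup G p P" "Q \<subseteq> carrier G"
        "\<forall>g\<in>carrier G. \<exists>u\<in>P. \<exists>v\<in>Q. g = u \<otimes> v" "\<And>u v. \<lbrakk>u \<in> P; v \<in> Q\<rbrakk> \<Longrightarrow> u \<otimes> v = v \<otimes> u"
      using sylow by meson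
    have P: "subgroup P G" "card P = p ^ multiplicity p (order G)"
      using PQ(1) unfolding sylow_subgroup_def by auto
    have "g \<otimes> x \<otimes> inv g \<in> P" if "g \<in> P" "x \<in> P" for g x
      using that P(1) by (simp add: subgroup.m_closed subgroup.m_inv_closed)
    moreover have "g \<otimes> x \<otimes> inv g = x" if g: "g \<in> Q" "x \<in> P" for g x
      using PQ(4)[OF g(2,1)] g PQ(2) subgroup.mem_carrier[OF P(1) g(2)]
      by (metis inv_solve_right subsetD m_closed)
    ultimately show "\<exists>P Q S k. subgroup P G \<and> card P = p ^ k \<and> Q \<subseteq> carrier G \<and>
        (\<forall>g\<in>carrier G. \<exists>u\<in>P. \<exists>v\<in>Q. g = u \<otimes> v) \<and> sylow_subgroup G p S \<and>
        (\<forall>g\<in>P. \<forall>x\<in>S. g \<otimes> x \<otimes> inv g \<in> S) \<and> (\<forall>g\<in>Q. \<forall>x\<in>S. g \<otimes> x \<otimes> inv g = x)"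
      using PQ P by blast
  qed (use N N.inv_op_closed2 in \<open>auto intro!: homI simp: m_assoc inv_mult_group inv_cancel_left\<close>)
qed

end

section \<open>Coprime torsion in abelian groups\<close>

text \<open>This is Bezout in the exponent. Both orders of the factors are recorded because the
  adjoint group need not be abelian and a brace element is later expanded in both ways.\<close>

lemma (in group) coprime_pow_decomposition:
  assumes x: "x \<in> carrier G" and cop: "coprime (m::nat) (n::nat)"
  obtains s t :: int where "x = (x [^] m) [^] s \<otimes> (x [^] n) [^] t" "x = (x [^] n) [^] t \<otimes> (x [^] m) [^] s"
proof -
  obtain s t :: int where st: "s * int m + t * int n = 1"
    using bezout_int[of "int m" "int n"] cop by auto
  have pow: "(x [^] k) [^] z = x [^] (z * int k)" for k :: nat and z :: int
    using int_pow_pow[OF x, of "int k" z] by (simp add: int_pow_int mult.commute)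
  show ?thesis
  proof (rule that)
    show "x = (x [^] m) [^] s \<otimes> (x [^] n) [^] t"
      unfolding pow using x st by (simp add: int_pow_mult[symmetric])
    show "x = (x [^] n) [^] t \<otimes> (x [^] m) [^] s"
      unfolding pow using x st by (simp add: int_pow_mult[symmetric] add.commute)
  qed
qed

lemma (in group) subgroup_pow_card:
  assumes "subgroup P G" "x \<in> P"
  shows "x [^] card P = \<one>"
  using group.pow_order_eq_1[OF subgroup_imp_group[OF assms(1)], of x] assms(2)
  by (simp add: order_def nat_pow_consistent[symmetric])

lemma prime_power_coprime_cofactor:
  assumes "prime (p::nat)" "N > 0"
  obtains m where "coprime (p ^ multiplicity p N) m" "p ^ multiplicity p N * m = N"
proof -
  obtain m where m: "N = p ^ multiplicity p N * m" "\<not> p dvd m"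
    using multiplicity_decompose'[of N p] assms by (metis not_prime_unit less_numeral_extra(3))
  thus ?thesis using that[of m] assms(1) prime_imp_coprime[of p m] by simp
qed

text \<open>For a coprime factorisation of the order of a finite abelian group, these are the
  complementary Hall subgroups. Describing them by an equation makes them stable under all
  endomorphisms, in particular under the left multiplications of a brace.\<close>

definition torsion :: "('a, 'b) monoid_scheme \<Rightarrow> nat \<Rightarrow> 'a set"
  where "torsion G n = {x \<in> carrier G. x [^]\<^bsub>G\<^esub> n = \<one>\<^bsub>G\<^esub>}"

context comm_group
begin

lemma torsion_subgroup: "subgroup (torsion G n) G"
  by (rule subgroupI) (auto simp: torsion_def nat_pow_inv nat_pow_distrib intro!: exI[of _ \<one>])

text \<open>One inclusion is Lagrange in \<open>P\<close>. For the other, the index m of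
  \<open>P\<close> is coprime to its order: the m-th power of a torsion element \<open>x\<close>
  lies in \<open>P\<close>, and by Bezout \<open>x\<close> is a power of it.\<close>

lemma sylow_subgroup_eq_torsion:
  assumes fin: "finite (carrier G)" and P: "sylow_subgroup G p P"
  shows "P = torsion G (p ^ multiplicity p (order G))"
proof
  let ?n = "p ^ multiplicity p (order G)"
  have p: "prime p" and sub: "subgroup P G" and card: "card P = ?n"
    using P unfolding sylow_subgroup_def by auto
  show "P \<subseteq> torsion G ?n"
    using subgroup_pow_card[OF sub] subgroup.mem_carrier[OF sub] card unfolding torsion_def by auto
  interpret P: normal P G by (rule subgroup_imp_normal[OF sub])
  have "order G > 0" using fin order_gt_0_iff_finite by simp
  then obtain m where cop: "coprime ?n m" and nm: "?n * m = order G"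
    using prime_power_coprime_cofactor[OF p] by blast
  have "?n \<noteq> 0" using p by auto
  hence m: "m = card (rcosets P)" using lagrange[OF sub] card nm by (metis mult.commute mult_cancel1)
  show "torsion G ?n \<subseteq> P"
  proof
    fix x assume "x \<in> torsion G ?n"
    hence x: "x \<in> carrier G" and xn: "x [^] ?n = \<one>" unfolding torsion_def by auto
    have order_FactGroup: "order (G Mod P) = m" by (simp add: m order_def FactGroup_def)
    have "(P #> x) [^]\<^bsub>G Mod P\<^esub> order (G Mod P) = \<one>\<^bsub>G Mod P\<^esub>"
      using x by (intro group.pow_order_eq_1[OF P.factorgroup_is_group]) (simp add: carrier_FactGroup)
    hence "P #> x [^] m = P"
      unfolding order_FactGroup P.FactGroup_pow[OF x] by simp
    hence "x [^] m \<in> P" using coset_join1[of P "x [^] m"] x sub P.subset by simp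
    moreover obtain s t :: int where "x = (x [^] m) [^] s \<otimes> (x [^] ?n) [^] t"
      using coprime_pow_decomposition[OF x cop] by metis
    ultimately show "x \<in> P" using xn subgroup_int_pow_closed[OF sub, of "x [^] m" s] x by (metis int_pow_one P.mem_carrier r_one)
  qed
qed

lemma torsion_sylow_subgroup:
  assumes fin: "finite (carrier G)" and p: "prime p"
  shows "sylow_subgroup G p (torsion G (p ^ multiplicity p (order G)))"
proof -
  have "order G = p ^ multiplicity p (order G) * (order G div p ^ multiplicity p (order G))"
    by (simp add: multiplicity_dvd)
  then obtain P where "subgroup P G" "card P = p ^ multiplicity p (order G)"
    using sylow_thm[OF p group_axioms _ fin] by blast
  hence "sylow_subgroup G p P" using p unfolding sylow_subgroup_def by blast
  thus ?thesis using sylow_subgroup_eq_torsion[OF fin] by metis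
qed

lemma torsion_coprime_inter:
  assumes "coprime n m" "x \<in> torsion G n" "x \<in> torsion G m"
  shows "x = \<one>"
  using coprime_pow_decomposition[of x n m] assms unfolding torsion_def by auto

lemma torsion_coprime_unique:
  assumes cop: "coprime n m" and u: "u \<in> torsion G n" "u' \<in> torsion G n"
    and v: "v \<in> torsion G m" "v' \<in> torsion G m" and eq: "u \<otimes> v = u' \<otimes> v'"
  shows "u = u' \<and> v = v'"
proof -
  have car: "u \<in> carrier G" "u' \<in> carrier G" "v \<in> carrier G" "v' \<in> carrier G"
    using u v unfolding torsion_def by auto
  have "inv u' \<otimes> (u \<otimes> v) \<otimes> inv v = inv u' \<otimes> (u' \<otimes> v') \<otimes> inv v" unfolding eq ..
  hence e: "inv u' \<otimes> u = v' \<otimes> inv v" using car by (simp add: m_assoc inv_cancel_left)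
  have "inv u' \<otimes> u \<in> torsion G n" "v' \<otimes> inv v \<in> torsion G m"
    using u v torsion_subgroup by (simp_all add: subgroup.m_closed subgroup.m_inv_closed)
  hence "inv u' \<otimes> u = \<one>" using e torsion_coprime_inter[OF cop] by metis
  hence "u = u'" using car by (metis inv_equality inv_inv inv_closed)
  thus ?thesis using eq car by simp
qed

lemma torsion_coprime_decomposition:
  assumes "coprime n m" "n * m = order G" "x \<in> carrier G"
  obtains u v where "u \<in> torsion G n" "v \<in> torsion G m" "x = u \<otimes> v"
proof -
  have *: "x [^] m \<in> torsion G n" "x [^] n \<in> torsion G m"
    using assms pow_order_eq_1[OF assms(3)] by (simp_all add: torsion_def nat_pow_pow mult.commute)
  obtain s t :: int where "x = (x [^] m) [^] t \<otimes> (x [^] n) [^] s"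
    using coprime_pow_decomposition[OF assms(3,1)] by metis
  thus ?thesis
    using that subgroup_int_pow_closed[OF torsion_subgroup] * by blast
qed

text \<open>This gives the size of the torsion subgroup of the cofactor of a prime power, to which
  Sylow's theorem does not apply directly.\<close>

lemma card_torsion_mult:
  assumes "coprime n m" "n * m = order G"
  shows "card (torsion G n) * card (torsion G m) = order G"
proof -
  have "inj_on (\<lambda>(u, v). u \<otimes> v) (torsion G n \<times> torsion G m)"
    by (rule inj_onI) (use torsion_coprime_unique[OF assms(1)] in auto)
  moreover have "(\<lambda>(u, v). u \<otimes> v) ` (torsion G n \<times> torsion G m) = carrier G"
  proof
    show "(\<lambda>(u, v). u \<otimes> v) ` (torsion G n \<times> torsion G m) \<subseteq> carrier G" unfolding torsion_def by auto
    show "carrier G \<subseteq> (\<lambda>(u, v). u \<otimes> v) ` (torsion G n \<times> torsion G m)"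
    proof
      fix x assume "x \<in> carrier G"
      from torsion_coprime_decomposition[OF assms this]
      show "x \<in> (\<lambda>(u, v). u \<otimes> v) ` (torsion G n \<times> torsion G m)" by auto
    qed
  qed
  ultimately show ?thesis
    by (metis card_cartesian_product card_image order_def)
qed

end

section \<open>Left braces\<close>

context left_brace
begin

section \<open>The action of the adjoint group on the additive group\<close>

lemma adjoint_group_simps:
  "carrier (adjoint_group A) = carrier A" "monoid.mult (adjoint_group A) = circ A" "\<one>\<^bsub>adjoint_group A\<^esub> = \<zero>"
  by (simp_all add: adjoint_group_def)

lemma order_adjoint_group: "order (adjoint_group A) = order (add_monoid A)"
  by (simp add: order_def adjoint_group_simps)

sublocale adj: group "adjoint_group A"
  rewrites "carrier (adjoint_group A) = carrier A" and "monoid.mult (adjoint_group A) = circ A"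
    and "\<one>\<^bsub>adjoint_group A\<^esub> = \<zero>"
  by (simp_all add: adjoint_group_simps adjoint_is_group)

definition lam :: "'a \<Rightarrow> 'a \<Rightarrow> 'a" where "lam a x = a \<otimes> x \<oplus> x"

lemma lam_closed [simp]: "\<lbrakk>a \<in> carrier A; x \<in> carrier A\<rbrakk> \<Longrightarrow> lam a x \<in> carrier A"
  unfolding lam_def by (simp add: brace_mult_closed)

lemma circ_eq_lam: "\<lbrakk>a \<in> carrier A; b \<in> carrier A\<rbrakk> \<Longrightarrow> circ A a b = a \<oplus> lam a b"
  unfolding circ_def lam_def by (simp add: brace_mult_closed a_ac)

lemma lam_add:
  "\<lbrakk>a \<in> carrier A; x \<in> carrier A; y \<in> carrier A\<rbrakk> \<Longrightarrow> lam a (x \<oplus> y) = lam a x \<oplus> lam a y"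
  unfolding lam_def by (simp add: brace_distrib brace_mult_closed a_ac)

lemma brace_mult_eq_lam: "\<lbrakk>a \<in> carrier A; x \<in> carrier A\<rbrakk> \<Longrightarrow> a \<otimes> x = lam a x \<oplus> \<ominus> x"
  unfolding lam_def by (simp add: brace_mult_closed a_assoc r_neg)

lemma lam_hom: "a \<in> carrier A \<Longrightarrow> lam a \<in> hom (add_monoid A) (add_monoid A)"
  by (rule homI) (simp_all add: lam_add)

text \<open>Associativity of the circle operation on \<open>a\<close>, \<open>b\<close>,
  \<open>x\<close>, expanded on both sides, leaves this after cancelling the summand
  \<open>circ A a b\<close>.\<close>

lemma lam_circ:
  assumes "a \<in> carrier A" "b \<in> carrier A" "x \<in> carrier A"
  shows "lam (circ A a b) x = lam a (lam b x)"
proof -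
  have "circ A a b \<oplus> lam (circ A a b) x = circ A (circ A a b) x"
    using assms by (simp add: circ_eq_lam)
  also have "\<dots> = circ A a (circ A b x)" using assms by (rule adj.m_assoc)
  also have "\<dots> = circ A a b \<oplus> lam a (lam b x)"
    using assms by (simp add: circ_eq_lam lam_add a_assoc)
  finally show ?thesis using assms by simp
qed

lemma lam_zero: "x \<in> carrier A \<Longrightarrow> lam \<zero> x = x"
  using adj.l_one[of x] by (simp add: circ_eq_lam)

lemma brace_mult_group_hom: "a \<in> carrier A \<Longrightarrow> group_hom (add_monoid A) (add_monoid A) ((\<otimes>) a)"
  using a_group by (auto simp: group_hom_def group_hom_axioms_def intro!: homI brace_mult_closed brace_distrib)

lemma brace_zero_right: "a \<in> carrier A \<Longrightarrow> a \<otimes> \<zero> = \<zero>"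
  using group_hom.hom_one[OF brace_mult_group_hom] by simp

lemma brace_zero_left: "x \<in> carrier A \<Longrightarrow> \<zero> \<otimes> x = \<zero>"
  by (simp add: brace_mult_eq_lam lam_zero r_neg)

lemma brace_circ:
  assumes "a \<in> carrier A" "b \<in> carrier A" "x \<in> carrier A"
  shows "circ A a b \<otimes> x = a \<otimes> x \<oplus> (b \<otimes> x \<oplus> a \<otimes> (b \<otimes> x))"
  using assms
  by (simp add: brace_mult_eq_lam[of "circ A a b" x] lam_circ, simp add: lam_def brace_distrib brace_mult_closed a_ac r_neg r_neg2)

section \<open>Torsion subgroups of the additive group\<close>

abbreviation tors :: "nat \<Rightarrow> 'a set" where "tors n \<equiv> torsion (add_monoid A) n"

lemma tors_iff: "x \<in> tors n \<longleftrightarrow> x \<in> carrier A \<and> [n] \<cdot> x = \<zero>"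
  by (simp add: torsion_def add_pow_def)

lemma tors_carrier: "x \<in> tors n \<Longrightarrow> x \<in> carrier A" by (simp add: torsion_def)

lemmas tors_subgroup = add.torsion_subgroup

lemma tors_mult:
  assumes "a \<in> carrier A" "x \<in> tors n"
  shows "a \<otimes> x \<in> tors n"
proof -
  interpret h: group_hom "add_monoid A" "add_monoid A" "(\<otimes>) a" by (rule brace_mult_group_hom[OF assms(1)])
  show ?thesis using assms(2) h.hom_nat_pow[of x n] h.hom_one h.hom_closed[of x] by (simp add: torsion_def)
qed

lemma tors_lam: "\<lbrakk>a \<in> carrier A; x \<in> tors n\<rbrakk> \<Longrightarrow> lam a x \<in> tors n"
  unfolding lam_def using subgroup.m_closed[OF tors_subgroup] tors_mult by simp

lemma tors_adjoint_subgroup: "subgroup (tors n) (adjoint_group A)"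
proof (rule adj.subgroupI)
  show "tors n \<subseteq> carrier A" "tors n \<noteq> {}"
    using tors_carrier subgroup.one_closed[OF tors_subgroup] by auto
next
  fix a assume a: "a \<in> tors n"
  let ?i = "inv\<^bsub>adjoint_group A\<^esub> a"
  have car: "a \<in> carrier A" "?i \<in> carrier A" using a tors_carrier by auto
  \<comment> \<open>The circle inverse of \<open>a\<close> is the negative of
    \<open>lam ?i a\<close>, so invariance under \<open>lam\<close> and closure under negation
    suffice.\<close>
  have "?i \<oplus> lam ?i a = \<zero>" using adj.l_inv[OF car(1)] car by (simp add: circ_eq_lam)
  hence "?i = \<ominus> lam ?i a" using car by (simp add: minus_equality)
  also have "\<dots> \<in> tors n" using subgroup.m_inv_closed[OF tors_subgroup tors_lam[OF car(2) a]] by (simp add: a_inv_def)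
  finally show "?i \<in> tors n" .
next
  fix a b assume "a \<in> tors n" "b \<in> tors n"
  thus "circ A a b \<in> tors n"
    using subgroup.m_closed[OF tors_subgroup] tors_lam tors_carrier by (simp add: circ_eq_lam)
qed

section \<open>Circle powers of an element with nilpotent left multiplication\<close>

lemma adjoint_pow_mult_mem:
  assumes c: "c \<in> carrier A" and L: "subgroup L (add_monoid A)" "L \<subseteq> L'" "L' \<subseteq> carrier A"
    and cL: "\<And>x. x \<in> L' \<Longrightarrow> c \<otimes> x \<in> L" and x: "x \<in> L'"
  shows "(c [^]\<^bsub>adjoint_group A\<^esub> (s::nat)) \<otimes> x \<in> L"
proof (induction s)
  case 0
  then show ?case using x L(3) brace_zero_left subgroup.one_closed[OF L(1)] by (auto simp: adjoint_group_simps)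
next
  case (Suc s)
  let ?d = "c [^]\<^bsub>adjoint_group A\<^esub> s"
  have d: "?d \<in> carrier A" using c by simp
  have "c [^]\<^bsub>adjoint_group A\<^esub> Suc s = circ A c ?d" using adj.nat_pow_Suc2[OF c] .
  \<comment> \<open>The last summand causes no trouble: \<open>?d \<otimes> x\<close> is in
    \<open>L\<close> by induction, hence in \<open>L'\<close>, and \<open>c\<close> maps
    \<open>L'\<close> into \<open>L\<close>.\<close>
  hence "(c [^]\<^bsub>adjoint_group A\<^esub> Suc s) \<otimes> x = c \<otimes> x \<oplus> (?d \<otimes> x \<oplus> c \<otimes> (?d \<otimes> x))"
    using brace_circ[OF c d] x L(3) by auto
  moreover have "c \<otimes> (?d \<otimes> x) \<in> L" using Suc L(2) cL by blast
  ultimately show ?case using cL[OF x] Suc subgroup.m_closed[OF L(1)] by simp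
qed

text \<open>Modulo L, the element d acts trivially on L', so that its circle powers are its multiples.\<close>

lemma adjoint_pow_cong_multiple:
  assumes L: "subgroup L (add_monoid A)" "L \<subseteq> L'" and L': "subgroup L' (add_monoid A)"
    and dL: "\<And>x. x \<in> L' \<Longrightarrow> d \<otimes> x \<in> L" and d: "d \<in> L'"
  shows "d [^]\<^bsub>adjoint_group A\<^esub> (i::nat) \<in> L' \<and> d [^]\<^bsub>adjoint_group A\<^esub> i \<oplus> \<ominus> ([i] \<cdot> d) \<in> L"
proof (induction i)
  case 0
  then show ?case using subgroup.one_closed[OF L(1)] subgroup.one_closed[OF L'] by (simp add: adjoint_group_simps r_neg)
next
  case (Suc i)
  let ?e = "d [^]\<^bsub>adjoint_group A\<^esub> i"
  have dc: "d \<in> carrier A" using d subgroup.mem_carrier[OF L'] by simp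
  hence ec: "?e \<in> carrier A" by simp
  have de: "d \<otimes> ?e \<in> L" using dL Suc by blast
  have e: "d [^]\<^bsub>adjoint_group A\<^esub> Suc i = d \<otimes> ?e \<oplus> (d \<oplus> ?e)"
    using adj.nat_pow_Suc2[OF dc] dc ec by (simp add: circ_def brace_mult_closed a_assoc)
  have "d [^]\<^bsub>adjoint_group A\<^esub> Suc i \<in> L'"
    unfolding e using de L(2) d Suc subgroup.m_closed[OF L'] by auto
  \<comment> \<open>The new error is the old one plus \<open>d \<otimes> ?e\<close>, which lies in
    \<open>L\<close> because \<open>?e\<close> is in \<open>L'\<close>; hence that membership is
    part of the induction.\<close>
  moreover have "d [^]\<^bsub>adjoint_group A\<^esub> Suc i \<oplus> \<ominus> ([Suc i] \<cdot> d) = d \<otimes> ?e \<oplus> (?e \<oplus> \<ominus> ([i] \<cdot> d))"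
    unfolding e using dc ec brace_mult_closed[OF dc ec] by (simp add: minus_add a_ac r_neg r_neg1 r_neg2)
  ultimately show ?case using de Suc subgroup.m_closed[OF L(1)] by simp
qed

text \<open>With n + 1 factors the left multiplication is applied n times; the unspecified exponent
  0 never occurs in this form.\<close>

lemma brace_pow_Suc: "brace_pow A a (Suc n) = (((\<otimes>) a) ^^ n) a"
  by (induction n) simp_all

lemma funpow_group_hom:
  assumes "c \<in> carrier A"
  shows "group_hom (add_monoid A) (add_monoid A) (((\<otimes>) c) ^^ k)"
proof (induction k)
  case 0
  then show ?case using a_group by (auto simp: group_hom_def group_hom_axioms_def intro!: homI)
next
  case (Suc k)
  then have "(\<lambda>x. c \<otimes> (((\<otimes>) c) ^^ k) x) \<in> hom (add_monoid A) (add_monoid A)"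
    using hom_compose[OF group_hom.homh group_hom.homh[OF brace_mult_group_hom[OF assms]]]
    by (simp add: comp_def)
  then show ?case using a_group by (simp add: group_hom_def group_hom_axioms_def comp_def)
qed

text \<open>Each passage to the N-th circle power moves one step down a chain of preimages of
  \<open>L\<close>. It is used with \<open>L\<close> the torsion of the cofactor of \<open>N\<close>
  in the additive order.\<close>

lemma adjoint_pow_mem:
  assumes c: "c \<in> carrier A" and L: "subgroup L (add_monoid A)" and cL: "\<And>x. x \<in> L \<Longrightarrow> c \<otimes> x \<in> L"
    and N: "\<And>x. x \<in> carrier A \<Longrightarrow> [(N::nat)] \<cdot> x \<in> L" and j: "(((\<otimes>) c) ^^ j) c \<in> L"
  shows "c [^]\<^bsub>adjoint_group A\<^esub> (N ^ j) \<in> L"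
proof -
  \<comment> \<open>The chain \<open>D k\<close> increases from \<open>D 0 = L\<close>,
    \<open>c\<close> maps \<open>D (Suc k)\<close> into \<open>D k\<close>, and the hypothesis
    \<open>j\<close> places \<open>c\<close> in \<open>D j\<close>.\<close>
  define D where "D k = {x \<in> carrier A. (((\<otimes>) c) ^^ k) x \<in> L}" for k
  have D_sub: "subgroup (D k) (add_monoid A)" for k
  proof -
    interpret h: group_hom "add_monoid A" "add_monoid A" "((\<otimes>) c) ^^ k" by (rule funpow_group_hom[OF c])
    show ?thesis
    proof (rule add.subgroupI)
      show "D k \<noteq> {}" using h.hom_one subgroup.one_closed[OF L] unfolding D_def by auto
    next
      fix x assume "x \<in> D k"
      thus "\<ominus> x \<in> D k" using h.hom_inv[of x] subgroup.m_inv_closed[OF L] unfolding D_def by (auto simp: a_inv_def)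
    next
      fix x y assume "x \<in> D k" "y \<in> D k"
      thus "x \<oplus> y \<in> D k" using h.hom_mult[of x y] subgroup.m_closed[OF L] unfolding D_def by auto
    qed (auto simp: D_def)
  qed
  have D_Suc: "D k \<subseteq> D (Suc k)" for k using cL unfolding D_def by auto
  have D_car: "D k \<subseteq> carrier A" for k unfolding D_def by auto
  have LD: "L \<subseteq> D k" for k
  proof (induction k)
    case 0
    then show ?case using subgroup.subset[OF L] unfolding D_def by auto
  qed (use D_Suc in blast)
  have cD: "c \<otimes> x \<in> D k" if "x \<in> D (Suc k)" for x k
    using that c brace_mult_closed unfolding D_def by (simp add: funpow_swap1)
  have "c [^]\<^bsub>adjoint_group A\<^esub> (N ^ i) \<in> D (j - i)" if "i \<le> j" for i
    using that
  proof (induction i)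
    case 0
    then show ?case using c j unfolding D_def by (simp add: adj.nat_pow_eone[simplified])
  next
    case (Suc i)
    let ?d = "c [^]\<^bsub>adjoint_group A\<^esub> (N ^ i)"
    have ji: "j - i = Suc (j - Suc i)" using Suc.prems by simp
    have d: "?d \<in> D (Suc (j - Suc i))" using Suc unfolding ji by simp
    have dc: "?d \<in> carrier A" using c by simp
    have dD: "?d \<otimes> x \<in> D (j - Suc i)" if "x \<in> D (Suc (j - Suc i))" for x
      by (rule adjoint_pow_mult_mem[OF c D_sub D_Suc D_car cD that])
    let ?e = "?d [^]\<^bsub>adjoint_group A\<^esub> N"
    \<comment> \<open>Modulo \<open>D (j - Suc i)\<close> the N-th circle power of \<open>?d\<close>
      is its N-multiple, which lies in \<open>L\<close> and so in every member of the chain.\<close>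
    have e: "?e \<oplus> \<ominus> ([N] \<cdot> ?d) \<in> D (j - Suc i)"
      using adjoint_pow_cong_multiple[OF D_sub D_Suc D_sub dD d, of N] by blast
    moreover have "[N] \<cdot> ?d \<in> D (j - Suc i)" using N[OF dc] LD by blast
    ultimately have "?e \<oplus> \<ominus> ([N] \<cdot> ?d) \<oplus> [N] \<cdot> ?d \<in> D (j - Suc i)"
      using subgroup.m_closed[OF D_sub] by simp
    hence "?e \<in> D (j - Suc i)" using dc by (simp add: a_assoc l_neg)
    thus ?case using c by (simp add: adj.nat_pow_pow mult.commute)
  qed
  from this[of j] show ?thesis unfolding D_def by simp
qed

lemma lam_trivial_if_nil:
  assumes cop: "coprime n m" and nm: "n * m = order (add_monoid A)"
    and a: "a \<in> tors n" and b: "b \<in> tors m" and nil: "(((\<otimes>) (a \<oplus> b)) ^^ j) (a \<oplus> b) = \<zero>"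
  shows "lam a b = b \<and> lam b a = a"
proof -
  define c where "c = a \<oplus> b"
  have car: "a \<in> carrier A" "b \<in> carrier A" using a b tors_carrier by auto
  have c: "c \<in> carrier A" unfolding c_def using car by simp
  \<comment> \<open>This is used for both orders of the factors: the circle power with exponent
    \<open>m ^ j\<close> lies in \<open>tors n\<close>, and the one with exponent
    \<open>n ^ j\<close> lies in \<open>tors m\<close>.\<close>
  have mem: "c [^]\<^bsub>adjoint_group A\<^esub> (k ^ j) \<in> tors l" if kl: "k * l = order (add_monoid A)" for k l
  proof (rule adjoint_pow_mem[OF c tors_subgroup tors_mult[OF c]])
    fix x assume x: "x \<in> carrier A"
    show "[k] \<cdot> x \<in> tors l"
      using add.pow_order_eq_1[of x] add.nat_pow_pow[of x l k] x kl by (simp add: tors_iff mult.commute)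
  next
    show "(((\<otimes>) c) ^^ j) c \<in> tors l"
      using nil subgroup.one_closed[OF tors_subgroup] unfolding c_def by simp
  qed
  define G where "G = adjoint_group A"
  have cop': "coprime (m ^ j) (n ^ j)" using cop by (simp add: coprime_commute)
  obtain s t :: int where "c = circ A ((c [^]\<^bsub>G\<^esub> (m ^ j)) [^]\<^bsub>G\<^esub> s) ((c [^]\<^bsub>G\<^esub> (n ^ j)) [^]\<^bsub>G\<^esub> t)"
    "c = circ A ((c [^]\<^bsub>G\<^esub> (n ^ j)) [^]\<^bsub>G\<^esub> t) ((c [^]\<^bsub>G\<^esub> (m ^ j)) [^]\<^bsub>G\<^esub> s)"
    using adj.coprime_pow_decomposition[OF c cop'] unfolding G_def by blast
  moreover define u where "u = (c [^]\<^bsub>G\<^esub> (m ^ j)) [^]\<^bsub>G\<^esub> s"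
  moreover define w where "w = (c [^]\<^bsub>G\<^esub> (n ^ j)) [^]\<^bsub>G\<^esub> t"
  ultimately have uw: "c = circ A u w" "c = circ A w u" by simp_all
  have u: "u \<in> tors n" unfolding u_def G_def
    using adj.subgroup_int_pow_closed[OF tors_adjoint_subgroup mem] nm by (simp add: mult.commute)
  have w: "w \<in> tors m" unfolding w_def G_def
    using adj.subgroup_int_pow_closed[OF tors_adjoint_subgroup mem] nm by simp
  have uwc: "u \<in> carrier A" "w \<in> carrier A" using u w tors_carrier by auto
  have uniq: "x = x' \<and> y = y'" if "x \<in> tors n" "x' \<in> tors n" "y \<in> tors m" "y' \<in> tors m" "x \<oplus> y = x' \<oplus> y'" for x x' y y'
    by (rule add.torsion_coprime_unique[OF cop that])
  \<comment> \<open>The expansion of \<open>circ A u w\<close> identifies \<open>u\<close> with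
    \<open>a\<close>, and that of \<open>circ A w u\<close> identifies \<open>w\<close> with
    \<open>b\<close>; the remaining components then give the two fixed-point equations.\<close>
  have "u = a \<and> lam u w = b"
    by (rule uniq[OF u a tors_lam[OF uwc(1) w] b]) (use uw(1) uwc in \<open>simp add: circ_eq_lam c_def[symmetric]\<close>)
  moreover have "lam w u = a \<and> w = b"
    by (rule uniq[OF tors_lam[OF uwc(2) u] a w b]) (use uw(2) uwc in \<open>simp add: circ_eq_lam c_def[symmetric] a_comm\<close>)
  ultimately show ?thesis by metis
qed

section \<open>Trivial cross actions and nilpotency of the adjoint group\<close>

lemma lam_trivial_imp_circ_comm:
  assumes "a \<in> carrier A" "b \<in> carrier A" "lam a b = b" "lam b a = a"
  shows "circ A a b = circ A b a"
  using assms by (simp add: circ_eq_lam a_comm)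

text \<open>Since \<open>lam\<close> preserves torsion, both circle products are sums of an
  n-torsion and an m-torsion element, and such components are unique.\<close>

lemma circ_comm_imp_lam_trivial:
  assumes cop: "coprime n m" and a: "a \<in> tors n" and b: "b \<in> tors m" and "circ A a b = circ A b a"
  shows "lam a b = b \<and> lam b a = a"
proof -
  have car: "a \<in> carrier A" "b \<in> carrier A" using a b tors_carrier by auto
  have "a \<oplus> lam a b = lam b a \<oplus> b" using assms(4) car by (simp add: circ_eq_lam a_comm)
  thus ?thesis
    using add.torsion_coprime_unique[OF cop a tors_lam[OF car(2) a] tors_lam[OF car(1) b] b] by auto
qed

lemma torsion_adjoint_sylow:
  assumes "finite (carrier A)" "prime p"
  shows "sylow_subgroup (adjoint_group A) p (tors (p ^ multiplicity p (order (add_monoid A))))"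
  using add.torsion_sylow_subgroup[of p] assms tors_adjoint_subgroup
  unfolding sylow_subgroup_def order_adjoint_group by simp

text \<open>Trivial cross actions turn the sum of two coprime torsion elements into their circle
  product, so the additive splitting becomes a factorisation of the adjoint group into a Sylow
  subgroup and a subgroup commuting with it.\<close>

lemma adjoint_nilpotent_if_lam_trivial:
  assumes fin: "finite (carrier A)"
    and triv: "\<And>n m a b. \<lbrakk>coprime n m; n * m = order (add_monoid A); a \<in> tors n; b \<in> tors m\<rbrakk> \<Longrightarrow> lam a b = b \<and> lam b a = a"
  shows "nilpotent_group (adjoint_group A)"
proof (rule adj.nilpotent_if_sylow_factors[OF fin])
  fix p :: nat assume p: "prime p"
  obtain m where cop: "coprime (p ^ multiplicity p (order (add_monoid A))) m"
    and nm: "p ^ multiplicity p (order (add_monoid A)) * m = order (add_monoid A)" (is "?n * _ = _")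
    using prime_power_coprime_cofactor[OF p, of "order (add_monoid A)"] add.order_gt_0_iff_finite fin by auto
  have "\<exists>u\<in>tors ?n. \<exists>v\<in>tors m. g = circ A u v" if g: "g \<in> carrier A" for g
  proof -
    obtain u v where uv: "u \<in> tors ?n" "v \<in> tors m" "g = u \<oplus> v"
      using add.torsion_coprime_decomposition[OF cop nm g] by auto
    hence "g = circ A u v" using triv[OF cop nm uv(1,2)] tors_carrier by (simp add: circ_eq_lam)
    thus ?thesis using uv by blast
  qed
  moreover have "circ A u v = circ A v u" if "u \<in> tors ?n" "v \<in> tors m" for u v
    using lam_trivial_imp_circ_comm triv[OF cop nm that] that tors_carrier by blast
  moreover have "tors m \<subseteq> carrier A" using tors_carrier by auto
  ultimately show "\<exists>P Q. sylow_subgroup (adjoint_group A) p P \<and> Q \<subseteq> carrier A \<and>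
      (\<forall>g\<in>carrier A. \<exists>u\<in>P. \<exists>v\<in>Q. g = circ A u v) \<and> (\<forall>u\<in>P. \<forall>v\<in>Q. circ A u v = circ A v u)"
    using torsion_adjoint_sylow[OF fin p] by blast
qed

text \<open>The two torsion subgroups have \<open>n\<close> and \<open>m\<close> elements and are
  also subgroups of the adjoint group. By Lagrange \<open>a\<close> and \<open>b\<close> have
  coprime circle exponents, so they commute in a nilpotent group.\<close>

lemma lam_trivial_if_adjoint_nilpotent:
  assumes fin: "finite (carrier A)" and nilp: "nilpotent_group (adjoint_group A)" and p: "prime p"
    and n: "n = p ^ multiplicity p (order (add_monoid A))"
    and cop: "coprime n m" and nm: "n * m = order (add_monoid A)" and a: "a \<in> tors n" and b: "b \<in> tors m"
  shows "lam a b = b \<and> lam b a = a"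
proof (rule circ_comm_imp_lam_trivial[OF cop a b])
  have n_card: "card (tors n) = n"
    using add.torsion_sylow_subgroup[of p] fin p n unfolding sylow_subgroup_def by simp
  have "n \<noteq> 0" using n p by auto
  moreover have "card (tors n) * card (tors m) = order (add_monoid A)"
    by (rule add.card_torsion_mult[OF cop nm])
  ultimately have m_card: "card (tors m) = m" using nm n_card by (metis mult_cancel1)
  show "circ A a b = circ A b a"
  proof (rule adj.nilpotent_imp_coprime_commute[OF nilp _ _ _ _ cop])
    show "a [^]\<^bsub>adjoint_group A\<^esub> n = \<zero>" "b [^]\<^bsub>adjoint_group A\<^esub> m = \<zero>"
      using adj.subgroup_pow_card[OF tors_adjoint_subgroup] a b n_card m_card by metis+
  qed (use a b tors_carrier in auto)
qed

lemma left_nil_if_adjoint_nilpotent: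
  assumes fin: "finite (carrier A)" and nilp: "nilpotent_group (adjoint_group A)"
  shows "\<exists>j. \<forall>c\<in>carrier A. \<forall>x\<in>carrier A. (((\<otimes>) c) ^^ j) x = \<zero>"
proof -
  \<comment> \<open>The subgroups are kept invariant under \<open>lam\<close>, so that the fixed
    coset argument applies again; the exponent \<open>j\<close> is uniform in \<open>c\<close> and
    grows by one with each enlargement.\<close>
  define good where "good N \<longleftrightarrow> subgroup N (add_monoid A) \<and> (\<forall>g\<in>carrier A. \<forall>x\<in>N. lam g x \<in> N) \<and>
    (\<exists>j. \<forall>c\<in>carrier A. \<forall>x\<in>N. (((\<otimes>) c) ^^ j) x = \<zero>)" for N
  have "good (carrier A)"
  proof (rule finite_ascending_property[OF fin, of good "{\<zero>}"])
    have "\<forall>c\<in>carrier A. \<forall>x\<in>{\<zero>}. (((\<otimes>) c) ^^ 0) x = \<zero>" by simp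
    moreover have "subgroup {\<zero>} (add_monoid A)" using add.triv_subgroup by simp
    ultimately show "good {\<zero>}" unfolding good_def by (auto simp: lam_def brace_zero_right intro!: exI[of _ 0])
  next
    fix N assume "good N" and NA: "N \<subset> carrier A"
    then obtain j where N: "subgroup N (add_monoid A)" "\<And>g x. \<lbrakk>g \<in> carrier A; x \<in> N\<rbrakk> \<Longrightarrow> lam g x \<in> N"
      and j: "\<And>c x. \<lbrakk>c \<in> carrier A; x \<in> N\<rbrakk> \<Longrightarrow> (((\<otimes>) c) ^^ j) x = \<zero>"
      unfolding good_def by blast
    have N_add: "x \<oplus> y \<in> N" if "x \<in> N" "y \<in> N" for x y using subgroup.m_closed[OF N(1)] that by simp
    have N_neg: "\<ominus> x \<in> N" if "x \<in> N" for x
      using subgroup.m_inv_closed[OF N(1) that] by (simp add: a_inv_def)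
    have "\<exists>x\<in>carrier (add_monoid A) - N. \<forall>g\<in>carrier (adjoint_group A). lam g x \<otimes>\<^bsub>add_monoid A\<^esub> inv\<^bsub>add_monoid A\<^esub> x \<in> N"
    \<comment> \<open>For each prime, the p-primary torsion serves both as the acting subgroup
      \<open>P\<close> and as the Sylow subgroup \<open>S\<close>; the complementary torsion serves
      as \<open>Q\<close>.\<close>
    proof (rule invariant_coset_exists[where G = "adjoint_group A" and H = "add_monoid A" and \<phi> = lam])
      fix p :: nat assume p: "prime p"
      define n where "n = p ^ multiplicity p (order (add_monoid A))"
      obtain m where cop: "coprime n m" and nm: "n * m = order (add_monoid A)"
        using prime_power_coprime_cofactor[OF p, of "order (add_monoid A)"] add.order_gt_0_iff_finite fin
        unfolding n_def by auto
      have triv: "lam u v = v \<and> lam v u = u" if "u \<in> tors n" "v \<in> tors m" for u v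
        by (rule lam_trivial_if_adjoint_nilpotent[OF fin nilp p n_def cop nm that])
      have "\<exists>u\<in>tors n. \<exists>v\<in>tors m. g = circ A u v" if g: "g \<in> carrier A" for g
      proof -
        obtain u v where uv: "u \<in> tors n" "v \<in> tors m" "g = u \<oplus> v"
          using add.torsion_coprime_decomposition[OF cop nm g] by auto
        hence "g = circ A u v" using triv[OF uv(1,2)] tors_carrier by (simp add: circ_eq_lam)
        thus ?thesis using uv by blast
      qed
      moreover have "sylow_subgroup (add_monoid A) p (tors n)" "subgroup (tors n) (adjoint_group A)" "card (tors n) = n"
        using add.torsion_sylow_subgroup[of p] fin p tors_adjoint_subgroup unfolding n_def sylow_subgroup_def by auto
      moreover have "\<forall>g\<in>tors n. \<forall>x\<in>tors n. lam g x \<in> tors n" "tors m \<subseteq> carrier A" "\<forall>g\<in>tors m. \<forall>x\<in>tors n. lam g x = x"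
        using tors_lam tors_carrier triv by auto
      ultimately show "\<exists>P Q S k. subgroup P (adjoint_group A) \<and> card P = p ^ k \<and> Q \<subseteq> carrier (adjoint_group A) \<and>
          (\<forall>g\<in>carrier (adjoint_group A). \<exists>u\<in>P. \<exists>v\<in>Q. g = u \<otimes>\<^bsub>adjoint_group A\<^esub> v) \<and> sylow_subgroup (add_monoid A) p S \<and>
          (\<forall>g\<in>P. \<forall>x\<in>S. lam g x \<in> S) \<and> (\<forall>g\<in>Q. \<forall>x\<in>S. lam g x = x)"
        unfolding adjoint_group_simps n_def by blast
    next
      show "N \<lhd> add_monoid A" using add.subgroup_imp_normal[OF N(1)] .
    qed (use fin N NA in \<open>auto simp: adjoint_group_simps lam_circ lam_zero lam_hom adjoint_is_group a_group\<close>)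
    then obtain x where x: "x \<in> carrier A" "x \<notin> N" "\<And>g. g \<in> carrier A \<Longrightarrow> g \<otimes> x \<in> N"
      by (auto simp: adjoint_group_simps brace_mult_eq_lam a_inv_def)
    \<comment> \<open>\<open>Z\<close> is the preimage of the common fixed points of
      \<open>lam\<close> on the quotient by \<open>N\<close>, since a product
      \<open>g \<otimes> x\<close> is \<open>lam g x\<close> minus \<open>x\<close>.\<close>
    define Z where "Z = {x \<in> carrier A. \<forall>g\<in>carrier A. g \<otimes> x \<in> N}"
    have NZ: "N \<subseteq> Z"
    proof
      fix x assume x: "x \<in> N"
      have "lam g x \<oplus> \<ominus> x \<in> N" if "g \<in> carrier A" for g using N(2)[OF that x] N_neg[OF x] N_add by blast
      moreover have "x \<in> carrier A" using x NA by blast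
      ultimately show "x \<in> Z" unfolding Z_def by (simp add: brace_mult_eq_lam)
    qed
    have "subgroup Z (add_monoid A)"
    proof (rule add.subgroupI)
      show "Z \<subseteq> carrier A" "Z \<noteq> {}" using NZ subgroup.one_closed[OF N(1)] unfolding Z_def by auto
    next
      fix z assume z: "z \<in> Z"
      have "g \<otimes> (\<ominus> z) \<in> N" if g: "g \<in> carrier A" for g
      proof -
        have "g \<otimes> (\<ominus> z) = \<ominus> (g \<otimes> z)"
          using group_hom.hom_inv[OF brace_mult_group_hom[OF g], of z] z unfolding Z_def by (simp add: a_inv_def)
        thus ?thesis using N_neg z g unfolding Z_def by simp
      qed
      thus "\<ominus> z \<in> Z" using z unfolding Z_def by simp
    next
      fix y z assume "y \<in> Z" "z \<in> Z"
      thus "y \<oplus> z \<in> Z" using N_add unfolding Z_def by (auto simp: brace_distrib)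
    qed
    moreover from this have "lam g z \<in> Z" if "g \<in> carrier A" "z \<in> Z" for g z
      using that NZ subgroup.m_closed[of Z "add_monoid A" "g \<otimes> z" z] unfolding lam_def Z_def by auto
    moreover have "(((\<otimes>) c) ^^ Suc j) z = \<zero>" if "c \<in> carrier A" "z \<in> Z" for c z
      using that j[of c "c \<otimes> z"] unfolding Z_def by (simp add: funpow_swap1)
    ultimately have "good Z" unfolding good_def by blast
    moreover have "x \<in> Z" using x unfolding Z_def by blast
    moreover have "Z \<subseteq> carrier A" unfolding Z_def by blast
    ultimately show "\<exists>T. good T \<and> N \<subset> T \<and> T \<subseteq> carrier A" using x(2) NZ by blast
  qed simp
  thus ?thesis unfolding good_def by blast
qed

end

theorem theorem13:
  fixes A :: "('a, 'b) ring_scheme" (structure)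
  assumes "left_brace A" and "finite (carrier A)"
  shows "(nilpotent_group (adjoint_group A) \<longleftrightarrow>
            (\<exists>m::nat. m > 0 \<and> (\<forall>a\<in>carrier A. brace_pow A a m = \<zero>))) \<and>
         (\<forall>(p::nat) (q::nat) P Q a b (n::nat).
            sylow_subgroup (add_monoid A) p P \<longrightarrow> sylow_subgroup (add_monoid A) q Q \<longrightarrow> p \<noteq> q \<longrightarrow>
            a \<in> P \<longrightarrow> b \<in> Q \<longrightarrow> n > 0 \<longrightarrow> brace_pow A (a \<oplus> b) n = \<zero> \<longrightarrow>
            a \<otimes> b = \<zero> \<and> b \<otimes> a = \<zero>)"
proof (intro conjI allI impI)
  interpret left_brace A by fact
  note fin = assms(2)
  show "nilpotent_group (adjoint_group A) \<longleftrightarrow>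
            (\<exists>m::nat. m > 0 \<and> (\<forall>a\<in>carrier A. brace_pow A a m = \<zero>))"
  proof
    assume "nilpotent_group (adjoint_group A)"
    then obtain j where "\<forall>c\<in>carrier A. (((\<otimes>) c) ^^ j) c = \<zero>"
      using left_nil_if_adjoint_nilpotent[OF fin] by blast
    hence "\<forall>c\<in>carrier A. brace_pow A c (Suc j) = \<zero>" by (simp only: brace_pow_Suc)
    thus "\<exists>m>0. \<forall>a\<in>carrier A. brace_pow A a m = \<zero>" by blast
  next
    assume "\<exists>m>0. \<forall>a\<in>carrier A. brace_pow A a m = \<zero>"
    then obtain j where j: "\<forall>c\<in>carrier A. brace_pow A c (Suc j) = \<zero>" by (metis gr0_conv_Suc)
    show "nilpotent_group (adjoint_group A)"
    proof (rule adjoint_nilpotent_if_lam_trivial[OF fin])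
      fix n m a b assume *: "coprime n m" "n * m = order (add_monoid A)" "a \<in> tors n" "b \<in> tors m"
      \<comment> \<open>The nil hypothesis is applied to the sum of the two components.\<close>
      have "brace_pow A (a \<oplus> b) (Suc j) = \<zero>" using j *(3,4) tors_carrier by blast
      thus "lam a b = b \<and> lam b a = a" using lam_trivial_if_nil[OF *] unfolding brace_pow_Suc by blast
    qed
  qed
next
  interpret left_brace A by fact
  note fin = assms(2)
  fix p q :: nat and P Q a b and n :: nat
  assume P: "sylow_subgroup (add_monoid A) p P" and Q: "sylow_subgroup (add_monoid A) q Q" and "p \<noteq> q"
    and a: "a \<in> P" and b: "b \<in> Q" and n: "n > 0" "brace_pow A (a \<oplus> b) n = \<zero>"
  let ?o = "order (add_monoid A)"
  have pq: "prime p" "prime q" using P Q unfolding sylow_subgroup_def by auto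
  have o: "?o > 0" using add.order_gt_0_iff_finite fin by simp
  obtain m where cop: "coprime (p ^ multiplicity p ?o) m" and nm: "p ^ multiplicity p ?o * m = ?o"
    using prime_power_coprime_cofactor[OF pq(1) o] by blast
  have aT: "a \<in> tors (p ^ multiplicity p ?o)"
    using add.sylow_subgroup_eq_torsion[OF _ P] fin a by simp
  \<comment> \<open>The q-part of the order divides the cofactor \<open>m\<close> of the p-part, so
    \<open>b\<close> is m-torsion and two distinct primes reduce to a coprime factorisation of the
    order.\<close>
  have "q ^ multiplicity q ?o dvd p ^ multiplicity p ?o * m" unfolding nm by (rule multiplicity_dvd)
  moreover have "coprime (q ^ multiplicity q ?o) (p ^ multiplicity p ?o)"
    using primes_coprime[OF pq(2,1)] \<open>p \<noteq> q\<close> by simp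
  ultimately have "q ^ multiplicity q ?o dvd m" by (simp add: coprime_dvd_mult_right_iff)
  then obtain k where k: "m = q ^ multiplicity q ?o * k" ..
  have bT: "b \<in> tors (q ^ multiplicity q ?o)"
    using add.sylow_subgroup_eq_torsion[OF _ Q] fin b by simp
  hence "b \<in> tors m"
    using add.nat_pow_pow[of b k "q ^ multiplicity q ?o"] add.nat_pow_one[of k] unfolding k tors_iff by (simp add: mult.commute)
  moreover obtain j where "n = Suc j" using n(1) gr0_conv_Suc by blast
  hence "(((\<otimes>) (a \<oplus> b)) ^^ j) (a \<oplus> b) = \<zero>" using n(2) by (simp only: brace_pow_Suc)
  ultimately have triv: "lam a b = b \<and> lam b a = a" using lam_trivial_if_nil[OF cop nm aT] by blast
  have "a \<in> carrier A" "b \<in> carrier A" using aT bT tors_carrier by auto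
  thus "a \<otimes> b = \<zero>" "b \<otimes> a = \<zero>" using triv by (simp_all add: brace_mult_eq_lam r_neg)
qed

end
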